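(* Let $A\in\mathbb{C}^{n\times n}$ be a Hermitian $J$-symmetric matrix. Let $V_{k+1}=[v_1,\dots,v_{k+1}]$, with $v_1,\dots,v_{k+1}\in\mathbb{C}^n$, be a matrix satisfying $$A V_k = V_k S_k + v_{k+1} b^{T},$$ where $V_k=[v_1,\dots,v_k]$, $S_k$ is a matrix in $\mathbb{R}^{k\times k}$, and $b$ is a vector in $\mathbb{R}^k$. Let $W_{k+1}=J V_{k+1}^{*}$ and $W_k = J V_k^{*}$. If the matrices $V_k$ and $W_k$ are orthogonal and $A$-orthogonal to each other, that is, $V_k^{H}W_k=O$ and $V_k^{H}AW_k=O$, then the matrices $V_{k+1}$ and $W_{k+1}$ also satisfy $$V_{k+1}^{H}W_{k+1}=O \quad\text{and}\quad V_{k+1}^{H}AW_{k+1}=O.$$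
   Context: Notation: $^{T}$ is the matrix transpose, $^{H}$ the Hermitian conjugate (conjugate transpose), $^{*}$ the entrywise complex conjugate, and $O$ a null matrix of appropriate size. Let $J\in\mathbb{R}^{n\times n}$ satisfy $J^{T}=-J$ and $J^{T}=J^{-1}$. A matrix $A\in\mathbb{C}^{n\times n}$ is called $J$-symmetric if $JAJ^{-1}=A^{T}$; it is Hermitian $J$-symmetric if in addition $A^{H}=A$.
   Formalization: The formal theorem assumes in addition that b is not the zero vector (so k ≥ 1); for b = 0 the relation does not constrain v_{k+1} and the claim fails, e.g. n=2, k=1, A=I, v_1=e_1, v_2=e_2, S_1=[1]. *)

theory Defs
  imports
    Jordan_Normal_Form.Matrix
    Jordan_Normal_Form.Gauss_Jordan_Elimination
    Jordan_Normal_Form.Schur_Decomposition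
begin

abbreviation cmat :: "real mat \<Rightarrow> complex mat" where
  "cmat \<equiv> map_mat complex_of_real"

abbreviation cvec :: "real vec \<Rightarrow> complex vec" where
  "cvec \<equiv> map_vec complex_of_real"

definition admissible_J :: "nat \<Rightarrow> real mat \<Rightarrow> bool" where
  "admissible_J n J \<longleftrightarrow>
     J \<in> carrier_mat n n \<and> transpose_mat J = - J \<and> mat_inverse J = Some (transpose_mat J)"

text \<open>This is meant for invertible \<open>J\<close>; otherwise \<open>the (mat_inverse J)\<close> is unspecified.\<close>
definition J_symmetric :: "nat \<Rightarrow> real mat \<Rightarrow> complex mat \<Rightarrow> bool" where
  "J_symmetric n J A \<longleftrightarrow>
     A \<in> carrier_mat n n \<and> cmat J * A * cmat (the (mat_inverse J)) = transpose_mat A"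

definition hermitian_J_symmetric :: "nat \<Rightarrow> real mat \<Rightarrow> complex mat \<Rightarrow> bool" where
  "hermitian_J_symmetric n J A \<longleftrightarrow> J_symmetric n J A \<and> mat_adjoint A = A"

text \<open>The \<open>n \<times> k\<close> matrix with columns \<open>v 1, \<dots>, v k\<close>; the value \<open>v 0\<close> is not used.\<close>
definition V_mat :: "nat \<Rightarrow> (nat \<Rightarrow> complex vec) \<Rightarrow> nat \<Rightarrow> complex mat" where
  "V_mat n v k = mat_of_cols n (map v [1..<k + 1])"

definition W_mat :: "nat \<Rightarrow> real mat \<Rightarrow> (nat \<Rightarrow> complex vec) \<Rightarrow> nat \<Rightarrow> complex mat" where
  "W_mat n J v k = cmat J * map_mat cnj (V_mat n v k)"

text \<open>The outer product \<open>v b\<^sup>T\<close>, as a column matrix times a row matrix.\<close>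
definition outer :: "'a::semiring_0 vec \<Rightarrow> 'a vec \<Rightarrow> 'a mat" where
  "outer v b = mat_of_cols (dim_vec v) [v] * mat_of_rows (dim_vec b) [b]"

end

theory Submission
  imports Defs
begin

text \<open>
  Consider the bilinear form \<open>\<omega>(x, y) = x\<^sup>T J y\<close> on complex vectors. It is alternating because
  \<open>J\<^sup>T = - J\<close>, and \<open>J\<close>-symmetry of \<open>A\<close> says that \<open>A\<close> is self-adjoint for it:
  \<open>\<omega>(A x, y) = \<omega>(x, A y)\<close>. As \<open>J\<close> is real, the entries of \<open>V\<^sup>H W\<close> are the complex conjugates of
  \<open>\<omega>(v\<^sub>i, v\<^sub>j)\<close>, and as \<open>A\<close> is Hermitian, those of \<open>V\<^sup>H A W\<close> are the conjugates of
  \<open>\<omega>(A v\<^sub>i, v\<^sub>j)\<close>. So everything is a statement about the form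
  (lemma \<open>adjoint_mult_form\<close>).

  Write \<open>w\<close> for the new vector and expand \<open>A v\<^sub>j\<close> by the recurrence inside
  \<open>0 = \<omega>(A v\<^sub>j, v\<^sub>i)\<close>: the part in the span of the old vectors contributes nothing, which leaves
  \<open>b\<^sub>j \<omega>(w, v\<^sub>i) = 0\<close>. Since some \<open>b\<^sub>j\<close> is nonzero, \<open>w\<close> is \<open>\<omega>\<close>-orthogonal to all old vectors,
  and to itself because the form is alternating. Expanding \<open>A v\<^sub>i\<close> in \<open>\<omega>(A v\<^sub>i, w)\<close> now gives
  zero as well (lemma \<open>recurrence_preserves_orthogonality\<close>). The remaining entry
  \<open>\<omega>(A w, w)\<close> vanishes because an alternating form with self-adjoint \<open>A\<close> makes
  \<open>\<omega>(A x, y)\<close> alternating too.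
\<close>

lemma skew_form_commute:
  fixes M :: "'a::comm_ring_1 mat"
  assumes M: "M \<in> carrier_mat n n" "transpose_mat M = - M"
    and x: "x \<in> carrier_vec n" and y: "y \<in> carrier_vec n"
  shows "x \<bullet> (M *\<^sub>v y) = - (y \<bullet> (M *\<^sub>v x))"
proof -
  have "x \<bullet> (M *\<^sub>v y) = (transpose_mat M *\<^sub>v x) \<bullet> y"
    using transpose_vec_mult_scalar[OF M(1) y x] by simp
  also have "\<dots> = y \<bullet> (transpose_mat M *\<^sub>v x)"
    using M x y by (intro comm_scalar_prod[where n = n]) auto
  also have "\<dots> = - (y \<bullet> (M *\<^sub>v x))"
    using M x y by simp
  finally show ?thesis .
qed

lemma skew_form_self:
  fixes M :: "'a::field_char_0 mat"
  assumes "M \<in> carrier_mat n n" "transpose_mat M = - M" "x \<in> carrier_vec n"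
  shows "x \<bullet> (M *\<^sub>v x) = 0"
  using skew_form_commute[OF assms assms(3)] by simp

text \<open>The commutation hypothesis is \<open>M A M\<inverse> = A\<^sup>T\<close> with the inverse cleared.\<close>
lemma form_self_adjoint:
  fixes M :: "'a::comm_ring_1 mat"
  assumes M: "M \<in> carrier_mat n n" and A: "A \<in> carrier_mat n n"
    and MA: "M * A = transpose_mat A * M"
    and x: "x \<in> carrier_vec n" and y: "y \<in> carrier_vec n"
  shows "x \<bullet> (M *\<^sub>v (A *\<^sub>v y)) = (A *\<^sub>v x) \<bullet> (M *\<^sub>v y)"
proof -
  have "M *\<^sub>v (A *\<^sub>v y) = transpose_mat A *\<^sub>v (M *\<^sub>v y)"
    using M A y MA
    by (metis assoc_mult_mat_vec transpose_carrier_mat)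
  moreover have "x \<bullet> (transpose_mat A *\<^sub>v (M *\<^sub>v y)) = (A *\<^sub>v x) \<bullet> (M *\<^sub>v y)"
    using transpose_vec_mult_scalar[of "transpose_mat A" n n "M *\<^sub>v y" x] M A x y by simp
  ultimately show ?thesis by simp
qed

lemma mult_mat_vec_orthogonal:
  fixes V :: "'a::comm_ring_1 mat"
  assumes V: "V \<in> carrier_mat n k" and c: "c \<in> carrier_vec k" and y: "y \<in> carrier_vec n"
    and orth: "\<And>i. i < k \<Longrightarrow> col V i \<bullet> y = 0"
  shows "(V *\<^sub>v c) \<bullet> y = 0"
proof -
  have "transpose_mat V *\<^sub>v y = 0\<^sub>v k"
    using V orth by (intro eq_vecI) auto
  moreover have "(V *\<^sub>v c) \<bullet> y = y \<bullet> (V *\<^sub>v c)"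
    using V c y by (intro comm_scalar_prod[where n = n]) auto
  ultimately show ?thesis
    using transpose_vec_mult_scalar[OF V c y] c by simp
qed

text \<open>
  The order of the two conclusions matters: \<open>A\<close>-orthogonality of the old vectors, tested against an
  index \<open>j\<close> with \<open>b\<^sub>j \<noteq> 0\<close>, forces \<open>w\<close> to be orthogonal to them, and only then does the
  recurrence give \<open>A\<close>-orthogonality to \<open>w\<close>.
\<close>
lemma recurrence_preserves_orthogonality:
  fixes M A V S :: "'a::field_char_0 mat"
  assumes M: "M \<in> carrier_mat n n" "transpose_mat M = - M"
    and A: "A \<in> carrier_mat n n"
    and V: "V \<in> carrier_mat n k" and S: "S \<in> carrier_mat k k"
    and w: "w \<in> carrier_vec n" and b: "b \<in> carrier_vec k" "b \<noteq> 0\<^sub>v k"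
    and rec: "\<And>j. j < k \<Longrightarrow> A *\<^sub>v col V j = V *\<^sub>v col S j + b $ j \<cdot>\<^sub>v w"
    and orth: "\<And>i j. i < k \<Longrightarrow> j < k \<Longrightarrow> col V i \<bullet> (M *\<^sub>v col V j) = 0"
    and A_orth: "\<And>i j. i < k \<Longrightarrow> j < k \<Longrightarrow> (A *\<^sub>v col V i) \<bullet> (M *\<^sub>v col V j) = 0"
    and i: "i < k"
  shows "col V i \<bullet> (M *\<^sub>v w) = 0" and "(A *\<^sub>v col V i) \<bullet> (M *\<^sub>v w) = 0"
proof -
  \<comment> \<open>Against a vector orthogonal to the columns of \<open>V\<close>, only the residual term of the recurrence
    survives. This is used with \<open>y\<close> a column of \<open>V\<close>, and then with \<open>y = w\<close>.\<close>
  have expand: "(A *\<^sub>v col V j) \<bullet> (M *\<^sub>v y) = b $ j * (w \<bullet> (M *\<^sub>v y))"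
    if j: "j < k" and y: "y \<in> carrier_vec n"
      and 0: "\<And>l. l < k \<Longrightarrow> col V l \<bullet> (M *\<^sub>v y) = 0" for j y
  proof -
    have My: "M *\<^sub>v y \<in> carrier_vec n" using M y by simp
    have Sj: "col S j \<in> carrier_vec k" using S j by auto
    have "(V *\<^sub>v col S j) \<bullet> (M *\<^sub>v y) = 0"
      using mult_mat_vec_orthogonal[OF V Sj My] 0 by blast
    then show ?thesis
      unfolding rec[OF j] using V Sj w My
      by (simp add: add_scalar_prod_distrib[where n = n])
  qed
  obtain j where j: "j < k" "b $ j \<noteq> 0"
    using b by (metis carrier_vecD eq_vecI index_zero_vec)
  have w_V: "col V l \<bullet> (M *\<^sub>v w) = 0" if l: "l < k" for l
  proof -
    have Vl: "col V l \<in> carrier_vec n" using V l by auto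
    have "b $ j * (w \<bullet> (M *\<^sub>v col V l)) = 0"
      using expand[OF j(1) Vl] orth[OF _ l] A_orth[OF j(1) l] by simp
    then show ?thesis
      using j(2) skew_form_commute[OF M Vl w] by simp
  qed
  then show "col V i \<bullet> (M *\<^sub>v w) = 0" using i by blast
  show "(A *\<^sub>v col V i) \<bullet> (M *\<^sub>v w) = 0"
    using expand[OF i w w_V] skew_form_self[OF M w] by simp
qed

lemma mat_adjoint_complex:
  fixes X :: "complex mat"
  shows "mat_adjoint X = map_mat cnj (transpose_mat X)"
  by (intro eq_matI) (auto simp: mat_adjoint_def mat_of_rows_index conjugate_complex_def)

text \<open>
  The left-hand entry is \<open>x\<^sup>H J y\<^sup>*\<close>, in which \<open>x\<close> and \<open>y\<close> both occur conjugated. Because \<open>J\<close> is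
  real, this is the conjugate of \<open>x\<^sup>T J y\<close>, so the sesquilinear conditions on \<open>V\<close> and \<open>W\<close> become
  conditions on a bilinear form in the columns of \<open>V\<close> alone.
\<close>
lemma adjoint_mult_form:
  fixes X Y :: "complex mat" and J :: "real mat"
  assumes J: "J \<in> carrier_mat n n" and X: "X \<in> carrier_mat n p" and Y: "Y \<in> carrier_mat n q"
    and i: "i < p" and j: "j < q"
  shows "(mat_adjoint X * (cmat J * map_mat cnj Y)) $$ (i, j)
    = cnj (col X i \<bullet> (cmat J *\<^sub>v col Y j))"
  using assms
  by (simp add: mat_adjoint_complex scalar_prod_def)

lemma J_symmetric_commute:
  assumes J: "admissible_J n J" and A: "J_symmetric n J A"
  shows "cmat J * A = transpose_mat A * cmat J"
proof -
  let ?M = "cmat J" and ?T = "cmat (transpose_mat J)"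
  have Jc: "J \<in> carrier_mat n n" and inv: "mat_inverse J = Some (transpose_mat J)"
    using J by (auto simp: admissible_J_def)
  have Ac: "A \<in> carrier_mat n n" and eq: "?M * A * ?T = transpose_mat A"
    using A inv by (auto simp: J_symmetric_def)
  have "transpose_mat J * J = 1\<^sub>m n"
    using mat_inverse(2)[OF Jc inv] by simp
  then have "?T * ?M = 1\<^sub>m n"
    using Jc by (metis of_real_hom.mat_hom_mult of_real_hom.mat_hom_one transpose_carrier_mat)
  then have "?M * A * ?T * ?M = ?M * A"
    using Jc Ac by (simp add: assoc_mult_mat[where n\<^sub>1 = n and n\<^sub>2 = n and n\<^sub>3 = n and n\<^sub>4 = n])
  then show ?thesis using eq by simp
qed

text \<open>Moving \<open>A\<close> to the left factor turns \<open>V\<^sup>H A W\<close> into a product to which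
  \<open>adjoint_mult_form\<close> applies, with \<open>X = A V\<close>.\<close>
lemma adjoint_mult_hermitian:
  fixes A V :: "complex mat"
  assumes A: "A \<in> carrier_mat n n" "mat_adjoint A = A" and V: "V \<in> carrier_mat n k"
  shows "mat_adjoint V * A = mat_adjoint (A * V)"
proof -
  have "mat_adjoint V * mat_adjoint A = mat_adjoint (A * V)"
    unfolding mat_adjoint_complex using A(1) V
    by (intro eq_matI) (auto simp: scalar_prod_def mult.commute)
  then show ?thesis using A(2) by simp
qed

lemma col_recurrence:
  fixes A V S :: "'a::comm_ring_1 mat"
  assumes A: "A \<in> carrier_mat n n" and V: "V \<in> carrier_mat n k" and S: "S \<in> carrier_mat k k"
    and w: "w \<in> carrier_vec n" and b: "b \<in> carrier_vec k"
    and rec: "A * V = V * S + outer w b" and j: "j < k"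
  shows "A *\<^sub>v col V j = V *\<^sub>v col S j + b $ j \<cdot>\<^sub>v w"
proof -
  have "A *\<^sub>v col V j = col (A * V) j"
    using A V j by auto
  also have "\<dots> = V *\<^sub>v col S j + b $ j \<cdot>\<^sub>v w"
    unfolding rec using V S w b j
    by (intro eq_vecI) (auto simp: outer_def scalar_prod_def mat_of_cols_def mat_of_rows_def mult.commute)
  finally show ?thesis .
qed

theorem theorem1:
  fixes n k :: nat and J S :: "real mat" and A :: "complex mat"
    and v :: "nat \<Rightarrow> complex vec" and b :: "real vec"
  assumes "admissible_J n J"
    and "hermitian_J_symmetric n J A"
    and "\<And>i. i \<in> {1..k + 1} \<Longrightarrow> v i \<in> carrier_vec n"
    and "S \<in> carrier_mat k k"
    and "b \<in> carrier_vec k"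
    and "b \<noteq> 0\<^sub>v k"
    and "A * V_mat n v k = V_mat n v k * cmat S + outer (v (k + 1)) (cvec b)"
    and "mat_adjoint (V_mat n v k) * W_mat n J v k = 0\<^sub>m k k"
    and "mat_adjoint (V_mat n v k) * A * W_mat n J v k = 0\<^sub>m k k"
  shows "mat_adjoint (V_mat n v (k + 1)) * W_mat n J v (k + 1) = 0\<^sub>m (k + 1) (k + 1)
    \<and> mat_adjoint (V_mat n v (k + 1)) * A * W_mat n J v (k + 1) = 0\<^sub>m (k + 1) (k + 1)"
proof -
  let ?M = "cmat J" and ?w = "v (k + 1)"
  have J: "J \<in> carrier_mat n n" and Jt: "transpose_mat J = - J"
    using assms(1) by (auto simp: admissible_J_def)
  have M: "?M \<in> carrier_mat n n" using J by simp
  have Mt: "transpose_mat ?M = - ?M"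
    using J arg_cong[OF Jt, of cmat] by (auto simp: map_mat_transpose)
  have A: "A \<in> carrier_mat n n" and Ah: "mat_adjoint A = A" and Js: "J_symmetric n J A"
    using assms(2) by (auto simp: hermitian_J_symmetric_def J_symmetric_def)
  note adj = form_self_adjoint[OF M A J_symmetric_commute[OF assms(1) Js]]
  have V: "V_mat n v m \<in> carrier_mat n m" for m
    by (intro carrier_matI) (simp_all add: V_mat_def del: upt_Suc)
  have col_V: "col (V_mat n v m) i = v (i + 1)" if "i < m" "m \<le> k + 1" for m i
    using that assms(3) by (simp add: V_mat_def nth_append del: upt_Suc)
  have vc: "v (i + 1) \<in> carrier_vec n" if "i < k + 1" for i
    using that assms(3) by simp
  have wc: "?w \<in> carrier_vec n" using vc[of k] by simp
  have entry: "(mat_adjoint (V_mat n v m) * W_mat n J v m) $$ (i, j)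
      = cnj (v (i + 1) \<bullet> (?M *\<^sub>v v (j + 1)))"
    if "i < m" "j < m" "m \<le> k + 1" for m i j
    using adjoint_mult_form[OF J V V that(1,2)] that by (simp add: W_mat_def col_V)
  have A_entry: "(mat_adjoint (V_mat n v m) * A * W_mat n J v m) $$ (i, j)
      = cnj ((A *\<^sub>v v (i + 1)) \<bullet> (?M *\<^sub>v v (j + 1)))"
    if "i < m" "j < m" "m \<le> k + 1" for m i j
  proof -
    have "col (A * V_mat n v m) i = A *\<^sub>v v (i + 1)"
      using col_mult2[OF A V[of m] that(1)] col_V[OF that(1,3)] by simp
    then show ?thesis
      using adjoint_mult_form[OF J mult_carrier_mat[OF A V] V that(1,2)] that
      by (simp add: adjoint_mult_hermitian[OF A Ah V] W_mat_def col_V)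
  qed
  have old: "v (i + 1) \<bullet> (?M *\<^sub>v v (j + 1)) = 0"
    and A_old: "(A *\<^sub>v v (i + 1)) \<bullet> (?M *\<^sub>v v (j + 1)) = 0" if "i < k" "j < k" for i j
    using entry[OF that] A_entry[OF that] that by (simp_all add: assms(8,9))
  have b: "cvec b \<in> carrier_vec k" "cvec b \<noteq> 0\<^sub>v k"
    using assms(5,6) by (auto simp: vec_eq_iff)
  have S: "cmat S \<in> carrier_mat k k" using assms(4) by simp
  have new: "v (i + 1) \<bullet> (?M *\<^sub>v ?w) = 0"
    and A_new: "(A *\<^sub>v v (i + 1)) \<bullet> (?M *\<^sub>v ?w) = 0" if "i < k" for i
    using recurrence_preserves_orthogonality[OF M Mt A V S wc b
        col_recurrence[OF A V S wc b(1) assms(7)] _ _ that] old A_old that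
    by (simp_all add: col_V)
  \<comment> \<open>Skew symmetry of both forms transfers the results for the last column to the last row, and
    makes the corner entries vanish.\<close>
  have sym: "x \<bullet> (?M *\<^sub>v y) = - (y \<bullet> (?M *\<^sub>v x))"
    and A_sym: "(A *\<^sub>v x) \<bullet> (?M *\<^sub>v y) = - ((A *\<^sub>v y) \<bullet> (?M *\<^sub>v x))"
    if "x \<in> carrier_vec n" "y \<in> carrier_vec n" for x y
    using skew_form_commute[OF M Mt that] skew_form_commute[OF M Mt _ that(2), of "A *\<^sub>v x"]
      adj[OF that(2,1)] A that by simp_all
  have all: "v (i + 1) \<bullet> (?M *\<^sub>v v (j + 1)) = 0 \<and> (A *\<^sub>v v (i + 1)) \<bullet> (?M *\<^sub>v v (j + 1)) = 0"
    if "i < k + 1" "j < k + 1" for i j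
  proof (cases "j < k")
    case j: True
    show ?thesis
    proof (cases "i < k")
      case True
      then show ?thesis using old A_old j by simp
    next
      case False
      then have "i = k" using that by simp
      then show ?thesis
        using sym[OF wc vc[OF that(2)]] A_sym[OF wc vc[OF that(2)]] new[OF j] A_new[OF j] by simp
    qed
  next
    case False
    then have j: "j = k" using that by simp
    show ?thesis
    proof (cases "i < k")
      case True
      then show ?thesis using new A_new j by simp
    next
      case False
      then have "i = k" using that by simp
      then show ?thesis using sym[OF wc wc] A_sym[OF wc wc] j by simp
    qed
  qed
  have dims: "mat_adjoint (V_mat n v (k + 1)) \<in> carrier_mat (k + 1) n"
    "W_mat n J v (k + 1) \<in> carrier_mat n (k + 1)"
    using V[of "k + 1"] J by (auto simp: mat_adjoint_def W_mat_def)
  show ?thesis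
    using entry[OF _ _ le_refl] A_entry[OF _ _ le_refl] all dims
    by (auto intro!: eq_matI simp del: index_mult_mat(1))
qed

end
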